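(* There exists a subgroup $\Gamma$ of $\mathrm{B}(\mathbf Q,\leq)$ which acts on $\mathbf Q$ transitively and proximally but not doubly-transitively.
   Context: $\mathrm{B}(\mathbf Q,\leq)$ is the group of order preserving bijections $g$ of $\mathbf Q$ that are boundedly supported, i.e. there are $a,b\in\mathbf Q$ such that $g(x)\ne x$ only if $a<x<b$. The action of $\Gamma$ is proximal if for every $a<b$ and $c<d$ in $\mathbf Q$ there is $g\in\Gamma$ such that $g(a,b)\supseteq(c,d)$, where $(a,b)=\{y\in\mathbf Q:a<y<b\}$. The action is doubly-transitive if it is transitive on ordered pairs, i.e. for every $a<b$ and $c<d$ in $\mathbf Q$ there is $g\in\Gamma$ with $g(a)=c$ and $g(b)=d$. *)

theory Defs
  imports Complex_Main "HOL-Algebra.Group_Action"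
begin

definition boundedly_supported :: "(rat \<Rightarrow> rat) \<Rightarrow> bool" where
  "boundedly_supported g \<longleftrightarrow> (\<exists>a b. \<forall>x. g x \<noteq> x \<longrightarrow> a < x \<and> x < b)"

definition BQ :: "(rat \<Rightarrow> rat) monoid" where
  "BQ = (BijGroup UNIV)\<lparr>carrier := {g \<in> Bij UNIV. mono g \<and> boundedly_supported g}\<rparr>"

definition proximal :: "(rat \<Rightarrow> rat) set \<Rightarrow> bool" where
  "proximal \<Gamma> \<longleftrightarrow> (\<forall>a b c d. a < b \<longrightarrow> c < d \<longrightarrow> (\<exists>g\<in>\<Gamma>. {c<..<d} \<subseteq> g ` {a<..<b}))"

text \<open>Transitivity on ordered pairs, that is, on pairs \<open>(a, b)\<close> with \<open>a < b\<close>.\<close>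

definition doubly_transitive :: "(rat \<Rightarrow> rat) set \<Rightarrow> bool" where
  "doubly_transitive \<Gamma> \<longleftrightarrow> (\<forall>a b c d. a < b \<longrightarrow> c < d \<longrightarrow> (\<exists>g\<in>\<Gamma>. g a = c \<and> g b = d))"

lemma subgroup_carrier_BQ: "subgroup (carrier BQ) (BijGroup UNIV)"
proof (rule subgroup.intro)
  show "carrier BQ \<subseteq> carrier (BijGroup UNIV)"
    by (auto simp: BQ_def BijGroup_def)
  show "\<one>\<^bsub>BijGroup UNIV\<^esub> \<in> carrier BQ"
    using id_Bij[of "UNIV :: rat set"]
    by (auto simp: BQ_def BijGroup_def boundedly_supported_def mono_def)
next
  fix f g assume fg: "f \<in> carrier BQ" "g \<in> carrier BQ"
  obtain a b where ab: "\<And>x. f x \<noteq> x \<Longrightarrow> a < x \<and> x < b"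
    using fg(1) by (auto simp: BQ_def boundedly_supported_def)
  obtain c d where cd: "\<And>x. g x \<noteq> x \<Longrightarrow> c < x \<and> x < d"
    using fg(2) by (auto simp: BQ_def boundedly_supported_def)
  have "f (g x) \<noteq> x \<Longrightarrow> min a c < x \<and> x < max b d" for x
    using ab[of x] cd[of x] by (cases "g x = x") auto
  then have "boundedly_supported (compose UNIV f g)"
    unfolding boundedly_supported_def compose_def by auto
  moreover have "mono (compose UNIV f g)"
    using fg by (auto simp: BQ_def compose_def mono_def)
  ultimately show "f \<otimes>\<^bsub>BijGroup UNIV\<^esub> g \<in> carrier BQ"
    using fg by (auto simp: BQ_def BijGroup_def compose_Bij)
next
  fix f assume f: "f \<in> carrier BQ"
  then have bij: "bij f" and m: "mono f" and B: "f \<in> Bij UNIV"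
    by (auto simp: BQ_def Bij_def)
  obtain a b where ab: "\<And>x. f x \<noteq> x \<Longrightarrow> a < x \<and> x < b"
    using f by (auto simp: BQ_def boundedly_supported_def)
  have "inv_into UNIV f x \<noteq> x \<Longrightarrow> a < x \<and> x < b" for x
    using ab[of x] by (metis bij bij_inv_eq_iff)
  then have "boundedly_supported (inv_into UNIV f)"
    unfolding boundedly_supported_def by blast
  moreover have "mono (inv_into UNIV f)"
  proof (rule monoI)
    fix x y :: rat assume "x \<le> y"
    then have *: "f (inv_into UNIV f x) \<le> f (inv_into UNIV f y)" using bij by (simp add: bij_is_surj surj_f_inv_f)
    show "inv_into UNIV f x \<le> inv_into UNIV f y"
    proof (rule ccontr)
      assume "\<not> ?thesis"
      then have lt: "inv_into UNIV f y < inv_into UNIV f x" by simp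
      then have "f (inv_into UNIV f y) \<le> f (inv_into UNIV f x)" using m by (simp add: monoD)
      with * have "f (inv_into UNIV f y) = f (inv_into UNIV f x)" by simp
      with bij lt show False by (metis bij_is_inj injD less_irrefl)
    qed
  qed
  moreover have "inv_into UNIV f \<in> Bij UNIV"
    using bij by (simp add: Bij_def bij_imp_bij_inv)
  ultimately show "inv\<^bsub>BijGroup UNIV\<^esub> f \<in> carrier BQ"
    using B by (simp add: inv_BijGroup BQ_def restrict_UNIV)
qed

lemma group_BQ: "group BQ"
proof -
  have "BQ = (BijGroup UNIV)\<lparr>carrier := carrier BQ\<rparr>"
    by (simp add: BQ_def)
  then show ?thesis
    using group.subgroup_imp_group[OF group_BijGroup subgroup_carrier_BQ] by simp
qed

lemma transitive_action_subgroup_BQ_iff: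
  assumes "subgroup \<Gamma> BQ"
  shows "transitive_action (BQ\<lparr>carrier := \<Gamma>\<rparr>) UNIV (\<lambda>g. g) \<longleftrightarrow> (\<forall>x y. \<exists>g\<in>\<Gamma>. g x = y)"
proof -
  have sub: "\<Gamma> \<subseteq> Bij UNIV"
    using subgroup.subset[OF assms] by (auto simp: BQ_def)
  have "group_hom (BQ\<lparr>carrier := \<Gamma>\<rparr>) (BijGroup UNIV) (\<lambda>g. g)"
  proof (intro group_hom.intro group_hom_axioms.intro)
    show "group (BQ\<lparr>carrier := \<Gamma>\<rparr>)"
      by (rule group.subgroup_imp_group[OF group_BQ assms])
    show "group (BijGroup (UNIV :: rat set))"
      by (rule group_BijGroup)
    show "(\<lambda>g. g) \<in> hom (BQ\<lparr>carrier := \<Gamma>\<rparr>) (BijGroup UNIV)"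
      using sub by (auto simp: hom_def BQ_def BijGroup_def)
  qed
  then show ?thesis
    by (auto simp: transitive_action_def transitive_action_axioms_def group_action_def)
qed

end

theory Submission
  imports Defs "HOL-Library.Countable_Set"
begin

text \<open>
  The group is an increasing union of groups \<open>G n\<close>, where \<open>G n\<close> is supported in the interval
  \<open>I n = (-(n+1), n+1)\<close> and has a wandering interval \<open>U n\<close> around \<open>0\<close>: each element of \<open>G n\<close>
  either fixes \<open>U n\<close> pointwise or moves it off itself. To pass from \<open>G n\<close> to \<open>G (n+1)\<close>, pick an
  interval \<open>V n\<close> in \<open>U n\<close> to the right of \<open>0\<close> and adjoin a map \<open>h n\<close>, supported in \<open>I (n+1)\<close>,
  that stretches \<open>V n\<close> onto \<open>I n\<close>. This gives proximality on the orbit \<open>X\<close> of \<open>0\<close>: if \<open>a = g 0\<close>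
  with \<open>g\<close> in \<open>G n\<close>, and \<open>b > a\<close> lies in the \<open>G n\<close>-orbit of \<open>0\<close>, then \<open>b\<close> lies outside the
  translate \<open>g U n\<close>, so \<open>h n \<circ> g\<inverse>\<close> maps \<open>(a, b)\<close> over \<open>I n\<close>.

  Let \<open>D n\<close> be \<open>I n\<close> without the \<open>G n\<close>-translates of \<open>V n\<close>; it contains the \<open>G n\<close>-orbit of \<open>0\<close>.
  By a ping-pong argument an element of \<open>G (n+1)\<close> moves \<open>D n\<close> off itself unless it agrees on
  \<open>D n\<close> with an element of \<open>G n\<close>. Hence wandering intervals persist, and pairs from the \<open>G n\<close>-orbit
  of \<open>0\<close> that are inequivalent under \<open>G n\<close> stay inequivalent for ever. Already for the cyclic group
  \<open>G 1\<close> there are inequivalent pairs. Finally \<open>X\<close> is a countable dense order without end points, so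
  by Cantor's theorem the action on \<open>X\<close> can be transported to the rationals.
\<close>

section \<open>Countable dense orders without end points\<close>

definition dense_unbounded :: "'a::linorder set \<Rightarrow> bool" where
  "dense_unbounded A \<longleftrightarrow> A \<noteq> {} \<and> (\<forall>x\<in>A. (\<exists>y\<in>A. y < x) \<and> (\<exists>y\<in>A. x < y))
    \<and> (\<forall>x\<in>A. \<forall>y\<in>A. x < y \<longrightarrow> (\<exists>z\<in>A. x < z \<and> z < y))"

text \<open>A relation instead of a partial function keeps the two orders on an equal footing:
  passing to the converse exchanges them. The equivalence of strict inequalities already forces
  single-valuedness and injectivity.\<close>

definition order_matching :: "('a::linorder \<times> 'b::linorder) set \<Rightarrow> bool" where
  "order_matching F \<longleftrightarrow>
    (\<forall>a b a' b'. (a, b) \<in> F \<longrightarrow> (a', b') \<in> F \<longrightarrow> (a < a' \<longleftrightarrow> b < b'))"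

lemma order_matching_less_iff:
  assumes "order_matching F" "(a, b) \<in> F" "(a', b') \<in> F"
  shows "a < a' \<longleftrightarrow> b < b'"
  using assms unfolding order_matching_def by blast

lemma order_matching_eq_iff:
  assumes "order_matching F" "(a, b) \<in> F" "(a', b') \<in> F"
  shows "a = a' \<longleftrightarrow> b = b'"
  using order_matching_less_iff[OF assms] order_matching_less_iff[OF assms(1,3,2)]
  by (metis less_irrefl linorder_neqE)

lemma order_matching_converse: "order_matching (F\<inverse>) \<longleftrightarrow> order_matching F"
  unfolding order_matching_def by blast

text \<open>Only \<open>Max L\<close> and \<open>Min R\<close> matter: density separates them, and
  the absence of end points handles an empty side.\<close>

lemma dense_unbounded_between:
  assumes B: "dense_unbounded B" and L: "finite L" "L \<subseteq> B" and R: "finite R" "R \<subseteq> B"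
    and LR: "\<And>l r. l \<in> L \<Longrightarrow> r \<in> R \<Longrightarrow> l < r"
  shows "\<exists>z\<in>B. (\<forall>l\<in>L. l < z) \<and> (\<forall>r\<in>R. z < r)"
proof (cases "L = {}")
  case LE: True
  show ?thesis
  proof (cases "R = {}")
    case True
    with LE B show ?thesis by (auto simp: dense_unbounded_def)
  next
    case False
    then have "Min R \<in> B" using R by (meson Min_in subset_iff)
    then obtain z where "z \<in> B" "z < Min R" using B unfolding dense_unbounded_def by blast
    then show ?thesis using LE R False by auto
  qed
next
  case LN: False
  then have MaxL: "Max L \<in> L" using L by simp
  show ?thesis
  proof (cases "R = {}")
    case True
    obtain z where "z \<in> B" "Max L < z" using B MaxL L(2) unfolding dense_unbounded_def by blast
    then show ?thesis using True LN L by auto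
  next
    case False
    then have MinR: "Min R \<in> R" using R by simp
    have "Max L \<in> B" "Min R \<in> B" using MaxL MinR L(2) R(2) by auto
    then have "\<exists>z\<in>B. Max L < z \<and> z < Min R"
      using B LR[OF MaxL MinR] unfolding dense_unbounded_def by simp
    then show ?thesis using LN L R False by auto
  qed
qed

text \<open>The forth step: the partners of the elements below \<open>a\<close> and of those above
  \<open>a\<close> form two finite sets, one entirely below the other, and a new partner fits in
  between.\<close>

lemma order_matching_extend:
  assumes "finite F" "F \<subseteq> A \<times> B" "order_matching F" "dense_unbounded B"
  shows "\<exists>b\<in>B. order_matching (insert (a, b) F)"
proof (cases "\<exists>b. (a, b) \<in> F")
  case True
  then show ?thesis using assms(2,3) by (metis SigmaD2 insert_absorb subset_iff)
next
  case False
  define L where "L = snd ` {p \<in> F. fst p < a}"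
  define R where "R = snd ` {p \<in> F. a < fst p}"
  have "\<exists>z\<in>B. (\<forall>l\<in>L. l < z) \<and> (\<forall>r\<in>R. z < r)"
  proof (rule dense_unbounded_between[OF assms(4)])
    fix l r assume "l \<in> L" "r \<in> R"
    then obtain x y where "(x, l) \<in> F" "(y, r) \<in> F" "x < a" "a < y"
      unfolding L_def R_def by auto
    then show "l < r" using order_matching_less_iff[OF assms(3)] by (meson less_trans)
  qed (use assms(1,2) in \<open>auto simp: L_def R_def\<close>)
  then obtain b where b: "b \<in> B" "\<And>l. l \<in> L \<Longrightarrow> l < b" "\<And>r. r \<in> R \<Longrightarrow> b < r" by blast
  have side: "(x < a \<longleftrightarrow> y < b) \<and> (a < x \<longleftrightarrow> b < y)" if "(x, y) \<in> F" for x y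
  proof -
    have "x \<noteq> a" using that False by blast
    then consider "x < a" | "a < x" by (meson linorder_neqE)
    then show ?thesis
    proof cases
      case 1
      then have "y \<in> L" using that unfolding L_def by force
      then show ?thesis using b(2) 1 by (meson less_asym)
    next
      case 2
      then have "y \<in> R" using that unfolding R_def by force
      then show ?thesis using b(3) 2 by (meson less_asym)
    qed
  qed
  have "order_matching (insert (a, b) F)"
    unfolding order_matching_def using side order_matching_less_iff[OF assms(3)] by auto
  with b(1) show ?thesis by blast
qed

text \<open>Back and forth: stage \<open>n\<close> of a chain of finite matchings takes in the
  \<open>n\<close>-th element of each side, so the union is a matching defined on all of
  \<open>A\<close> and onto \<open>B\<close>.\<close>

theorem cantor_isomorphism:
  fixes A :: "'a::linorder set" and B :: "'b::linorder set"
  assumes A: "countable A" "dense_unbounded A" and B: "countable B" "dense_unbounded B"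
  shows "\<exists>f. bij_betw f A B \<and> strict_mono_on A f"
proof -
  have ne: "A \<noteq> {}" "B \<noteq> {}" using A B by (auto simp: dense_unbounded_def)
  define \<alpha> where "\<alpha> = from_nat_into A"
  define \<beta> where "\<beta> = from_nat_into B"
  have \<alpha>: "range \<alpha> = A" and \<beta>: "range \<beta> = B"
    unfolding \<alpha>_def \<beta>_def using A B ne by (auto simp: range_from_nat_into)
  define P where "P F \<longleftrightarrow> finite F \<and> F \<subseteq> A \<times> B \<and> order_matching F" for F :: "('a \<times> 'b) set"
  have "\<exists>F. \<forall>n. P (F n) \<and> F n \<subseteq> F (Suc n) \<and> \<alpha> n \<in> Domain (F (Suc n)) \<and> \<beta> n \<in> Range (F (Suc n))"
  proof (rule dependent_nat_choice)
    show "\<exists>F. P F" unfolding P_def by (rule exI[of _ "{}"]) (simp add: order_matching_def)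
  next
    fix F n assume F: "P F"
    have an: "\<alpha> n \<in> A" and bn: "\<beta> n \<in> B" using \<alpha> \<beta> by auto
    obtain b where b: "b \<in> B" "order_matching (insert (\<alpha> n, b) F)"
      using order_matching_extend[of F A B] F B unfolding P_def by blast
    define F' where "F' = insert (\<alpha> n, b) F"
    \<comment> \<open>The back half is the forth step for the converse, with the two orders
      exchanged.\<close>
    have F': "finite (F'\<inverse>)" "F'\<inverse> \<subseteq> B \<times> A" "order_matching (F'\<inverse>)"
      using F b an unfolding P_def F'_def order_matching_converse by auto
    obtain a where a: "a \<in> A" "order_matching (insert (\<beta> n, a) (F'\<inverse>))"
      using order_matching_extend[OF F' A(2)] by blast
    have "insert (\<beta> n, a) (F'\<inverse>) = (insert (a, \<beta> n) F')\<inverse>" by auto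
    then have "P (insert (a, \<beta> n) F')"
      using a F' bn order_matching_converse unfolding P_def by auto
    moreover have "F \<subseteq> insert (a, \<beta> n) F'" "\<alpha> n \<in> Domain (insert (a, \<beta> n) F')"
      "\<beta> n \<in> Range (insert (a, \<beta> n) F')"
      by (auto simp: F'_def)
    ultimately show "\<exists>F'. P F' \<and> F \<subseteq> F' \<and> \<alpha> n \<in> Domain F' \<and> \<beta> n \<in> Range F'" by blast
  qed
  then obtain F where F: "\<And>n. P (F n)" "\<And>n. F n \<subseteq> F (Suc n)"
    "\<And>n. \<alpha> n \<in> Domain (F (Suc n))" "\<And>n. \<beta> n \<in> Range (F (Suc n))" by blast
  define M where "M = (\<Union>n. F n)"
  have inc: "F m \<subseteq> F n" if "m \<le> n" for m n
    using lift_Suc_mono_le[of F] F(2) that by blast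
  have match: "order_matching M"
    unfolding order_matching_def
  proof (intro allI impI)
    fix a b a' b' assume "(a, b) \<in> M" "(a', b') \<in> M"
    then obtain m n where "(a, b) \<in> F m" "(a', b') \<in> F n" unfolding M_def by blast
    then have "(a, b) \<in> F (max m n)" "(a', b') \<in> F (max m n)"
      using inc[of m "max m n"] inc[of n "max m n"] by auto
    then show "a < a' \<longleftrightarrow> b < b'"
      using order_matching_less_iff F(1) unfolding P_def by blast
  qed
  have sub: "M \<subseteq> A \<times> B" using F(1) unfolding M_def P_def by blast
  have "\<alpha> n \<in> Domain M" "\<beta> n \<in> Range M" for n
    using F(3)[of n] F(4)[of n] unfolding M_def by blast+
  then have dom: "A \<subseteq> Domain M" and ran: "B \<subseteq> Range M" using \<alpha> \<beta> by auto
  have "\<forall>a\<in>A. \<exists>b. (a, b) \<in> M" using dom by blast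
  from bchoice[OF this] obtain f where f: "\<And>a. a \<in> A \<Longrightarrow> (a, f a) \<in> M" by blast
  have mono: "strict_mono_on A f"
    by (rule strict_mono_onI) (use f order_matching_less_iff[OF match] in blast)
  have "f ` A = B"
  proof
    show "f ` A \<subseteq> B" using f sub by auto
    show "B \<subseteq> f ` A"
    proof
      fix b assume "b \<in> B"
      then obtain a where "(a, b) \<in> M" using ran by blast
      moreover from this have "a \<in> A" using sub by blast
      ultimately show "b \<in> f ` A" using f order_matching_eq_iff[OF match] by blast
    qed
  qed
  with mono show ?thesis
    using strict_mono_on_imp_inj_on unfolding bij_betw_def by blast
qed

section \<open>Groups of bijections and ping-pong\<close>

text \<open>The notation \<open>inv\<close> is taken by the group inverse of HOL-Algebra.\<close>

abbreviation inv_fun :: "('a \<Rightarrow> 'b) \<Rightarrow> 'b \<Rightarrow> 'a" where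
  "inv_fun \<equiv> inv_into UNIV"

text \<open>The generated group, encoded by words that grow on the left by one letter or inverse
  letter. Induction thus follows the letter applied last, as the ping-pong argument
  requires.\<close>

inductive_set gen :: "('a \<Rightarrow> 'a) set \<Rightarrow> ('a \<Rightarrow> 'a) set" for S where
  gen_id: "id \<in> gen S"
| gen_fun: "s \<in> S \<Longrightarrow> f \<in> gen S \<Longrightarrow> s \<circ> f \<in> gen S"
| gen_inv: "s \<in> S \<Longrightarrow> f \<in> gen S \<Longrightarrow> inv_fun s \<circ> f \<in> gen S"

lemma gen_incl: "s \<in> S \<Longrightarrow> s \<in> gen S"
  using gen_fun[OF _ gen_id] by fastforce

lemma gen_incl_inv: "s \<in> S \<Longrightarrow> inv_fun s \<in> gen S"
  using gen_inv[OF _ gen_id] by fastforce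

lemma gen_comp:
  assumes "f \<in> gen S" "g \<in> gen S"
  shows "f \<circ> g \<in> gen S"
  using assms(1)
proof induction
  case gen_id
  then show ?case using assms(2) by (simp only: id_comp)
next
  case (gen_fun s f)
  from gen_fun(1,3) show ?case unfolding comp_assoc by (rule gen.gen_fun)
next
  case (gen_inv s f)
  from gen_inv(1,3) show ?case unfolding comp_assoc by (rule gen.gen_inv)
qed

lemma gen_subset:
  assumes "f \<in> gen S" "S \<subseteq> T"
  shows "f \<in> gen T"
  using assms(1)
proof induction
  case gen_id
  show ?case by (rule gen.gen_id)
next
  case (gen_fun s f)
  from assms(2) gen_fun(1) have "s \<in> T" ..
  then show ?case using gen_fun(3) by (rule gen.gen_fun)
next
  case (gen_inv s f)
  from assms(2) gen_inv(1) have "s \<in> T" ..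
  then show ?case using gen_inv(3) by (rule gen.gen_inv)
qed

text \<open>A cyclic group is abelian; this settles the bottom level of the tower.\<close>

lemma gen_singleton_commute:
  assumes "f \<in> gen {s}" "bij s"
  shows "f (s x) = s (f x)"
  using assms(1)
  by induction (simp_all add: assms(2) bij_is_inj bij_is_surj surj_f_inv_f)

text \<open>A word has only finitely many letters, so the group generated by the whole sequence is
  the union of those generated by its initial segments.\<close>

lemma gen_range:
  fixes h :: "nat \<Rightarrow> 'a \<Rightarrow> 'a"
  assumes "f \<in> gen (range h)"
  shows "\<exists>n. f \<in> gen (h ` {..<n})"
  using assms
proof induction
  case gen_id
  show ?case by (rule exI, rule gen.gen_id)
next
  case (gen_fun s f)
  obtain i where i: "s = h i" using gen_fun(1) by blast
  obtain n where n: "f \<in> gen (h ` {..<n})" using gen_fun(3) ..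
  have "s \<in> h ` {..<max n (Suc i)}" using i by simp
  moreover have "f \<in> gen (h ` {..<max n (Suc i)})" using n by (rule gen_subset) auto
  ultimately show ?case by (intro exI gen.gen_fun)
next
  case (gen_inv s f)
  obtain i where i: "s = h i" using gen_inv(1) by blast
  obtain n where n: "f \<in> gen (h ` {..<n})" using gen_inv(3) ..
  have "s \<in> h ` {..<max n (Suc i)}" using i by simp
  moreover have "f \<in> gen (h ` {..<max n (Suc i)})" using n by (rule gen_subset) auto
  ultimately show ?case by (intro exI gen.gen_inv)
qed

lemma gen_bij:
  assumes "f \<in> gen S" "\<And>s. s \<in> S \<Longrightarrow> bij s"
  shows "bij f"
  using assms(1)
proof induction
  case gen_id
  show ?case by (rule bij_id)
next
  case (gen_fun s f)
  show ?case by (rule bij_comp[OF gen_fun(3) assms(2)[OF gen_fun(1)]])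
next
  case (gen_inv s f)
  show ?case by (rule bij_comp[OF gen_inv(3) bij_imp_bij_inv[OF assms(2)[OF gen_inv(1)]]])
qed

lemma gen_inverse:
  assumes "f \<in> gen S" and S: "\<And>s. s \<in> S \<Longrightarrow> bij s"
  shows "inv_fun f \<in> gen S"
  using assms(1)
proof induction
  case gen_id
  then show ?case unfolding inv_id by (rule gen.gen_id)
next
  case (gen_fun s f)
  have "inv_fun (s \<circ> f) = inv_fun f \<circ> inv_fun s"
    using gen_fun gen_bij S by (metis o_inv_distrib)
  then show ?case using gen_fun gen_comp gen_incl_inv by metis
next
  case (gen_inv s f)
  have "inv_fun (inv_fun s \<circ> f) = inv_fun f \<circ> s"
    using gen_inv gen_bij S by (metis o_inv_distrib bij_imp_bij_inv inv_inv_eq)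
  then show ?case using gen_inv gen_comp gen_incl by metis
qed

lemma strict_mono_inv_bij:
  fixes f :: "'a::linorder \<Rightarrow> 'b::linorder"
  assumes "strict_mono f" "bij f"
  shows "strict_mono (inv_fun f)"
proof (rule strict_monoI)
  fix x y :: 'b assume "x < y"
  then show "inv_fun f x < inv_fun f y"
    using assms(2) by (subst strict_mono_less[OF assms(1), symmetric]) (simp add: bij_is_surj surj_f_inv_f)
qed

lemma gen_strict_mono:
  fixes S :: "('a::linorder \<Rightarrow> 'a) set"
  assumes "f \<in> gen S" and S: "\<And>s. s \<in> S \<Longrightarrow> bij s" "\<And>s. s \<in> S \<Longrightarrow> strict_mono s"
  shows "strict_mono f"
  using assms(1)
proof induction
  case gen_id
  then show ?case by (simp add: strict_mono_def)
next
  case (gen_fun s f)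
  then show ?case using S by (simp add: strict_mono_def)
next
  case (gen_inv s f)
  then have "strict_mono (inv_fun s)" using S strict_mono_inv_bij by blast
  then show ?case using gen_inv by (simp add: strict_mono_def)
qed

lemma gen_fixes:
  assumes "f \<in> gen S" "\<And>s. s \<in> S \<Longrightarrow> bij s" "\<And>s. s \<in> S \<Longrightarrow> s x = x"
  shows "f x = x"
  using assms(1) by induction (simp_all add: assms(3) bij_is_inj[OF assms(2)] inv_f_eq)

section \<open>Ping-pong for a group with one adjoined map\<close>

locale ping_pong =
  fixes S :: "('a \<Rightarrow> 'a) set" and I V :: "'a set" and h :: "'a \<Rightarrow> 'a"
  assumes bij_S: "s \<in> S \<Longrightarrow> bij s" and bij_h: "bij h"
    and h_V: "h ` V = I" and V_I: "V \<subseteq> I"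
    and outside: "s \<in> S \<Longrightarrow> x \<notin> I \<Longrightarrow> s x = x"
    and wandering: "g \<in> gen S \<Longrightarrow> (\<forall>x\<in>V. g x = x) \<or> g ` V \<inter> V = {}"
begin

definition D :: "'a set" where
  "D = I - (\<Union>g\<in>gen S. g ` V)"

lemma bij_gen: "g \<in> gen S \<Longrightarrow> bij g"
  by (erule gen_bij) (rule bij_S)

lemma inv_gen: "g \<in> gen S \<Longrightarrow> inv_fun g \<in> gen S"
  by (erule gen_inverse) (rule bij_S)

lemma gen_outside: "g \<in> gen S \<Longrightarrow> x \<notin> I \<Longrightarrow> g x = x"
  by (erule gen_fixes) (simp_all add: bij_S outside)

lemma gen_inside:
  assumes "g \<in> gen S" "x \<in> I"
  shows "g x \<in> I"
proof (rule ccontr)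
  assume "g x \<notin> I"
  then have "g (g x) = g x" by (rule gen_outside[OF assms(1)])
  then have "g x = x" by (rule injD[OF bij_is_inj[OF bij_gen[OF assms(1)]]])
  with assms(2) \<open>g x \<notin> I\<close> show False by simp
qed

lemma gen_D:
  assumes "g \<in> gen S" "x \<in> D"
  shows "g x \<in> D"
proof -
  have "g x \<notin> k ` V" if "k \<in> gen S" for k
  proof
    assume "g x \<in> k ` V"
    then obtain v where v: "g x = k v" "v \<in> V" by (rule imageE)
    have "x = (inv_fun g \<circ> k) v"
      using bij_gen[OF assms(1)] by (simp add: bij_is_inj flip: v(1))
    moreover have "inv_fun g \<circ> k \<in> gen S"
      by (rule gen_comp[OF inv_gen[OF assms(1)] that])
    ultimately show False using assms(2) v(2) unfolding D_def by blast
  qed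
  then show ?thesis using gen_inside[OF assms(1)] assms(2) unfolding D_def by blast
qed

lemma D_not_V: "x \<in> D \<Longrightarrow> x \<notin> V"
proof
  assume "x \<in> D" "x \<in> V"
  then have "x \<in> id ` V" by simp
  then have "x \<in> (\<Union>g\<in>gen S. g ` V)" by (rule UN_I[OF gen_id])
  with \<open>x \<in> D\<close> show False unfolding D_def by blast
qed

lemma D_subset_I: "D \<subseteq> I"
  unfolding D_def by blast

text \<open>The ping-pong table: \<open>h\<close> throws the complement of \<open>V\<close> out of
  \<open>I\<close>, while its inverse draws \<open>I\<close> into \<open>V\<close>.\<close>

lemma h_in_I_iff: "h x \<in> I \<longleftrightarrow> x \<in> V"
  by (simp add: inj_image_mem_iff[OF bij_is_inj[OF bij_h]] flip: h_V)

lemma inv_h_in_V_iff: "inv_fun h x \<in> V \<longleftrightarrow> x \<in> I"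
  by (simp add: bij_h bij_is_surj surj_f_inv_f flip: h_in_I_iff)

text \<open>
  The possible behaviours on \<open>D\<close> of the elements of the larger group. According to the last rule
  used, the image of \<open>D\<close> lies in \<open>D\<close>, outside \<open>I\<close>, or in a translate \<open>g ` V\<close>. Only letters that
  do not cancel are appended, so once \<open>D\<close> has been left it is never met again.
\<close>

inductive reduced :: "('a \<Rightarrow> 'a) \<Rightarrow> bool" where
  base: "g \<in> gen S \<Longrightarrow> (\<And>x. x \<in> D \<Longrightarrow> w x = g x) \<Longrightarrow> reduced w"
| out: "reduced f \<Longrightarrow> (\<And>x. x \<in> D \<Longrightarrow> f x \<notin> V \<and> w x = h (f x)) \<Longrightarrow> reduced w"
| into: "reduced f \<Longrightarrow> g \<in> gen S \<Longrightarrow> (\<And>x. x \<in> D \<Longrightarrow> f x \<in> I \<and> w x = g (inv_fun h (f x))) \<Longrightarrow> reduced w"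

text \<open>Every rule constrains its function on \<open>D\<close> only. After a cancellation it is
  enough to agree with the shorter word there.\<close>

lemma reduced_cong:
  assumes "reduced f" and w: "\<And>x. x \<in> D \<Longrightarrow> w x = f x"
  shows "reduced w"
  using assms(1)
proof cases
  case (base g)
  then show ?thesis by (intro reduced.base[OF base(1)]) (simp add: w)
next
  case (out k)
  then show ?thesis by (intro reduced.out[OF out(1)]) (simp add: w)
next
  case (into k g)
  then show ?thesis by (intro reduced.into[OF into(1,2)]) (simp add: w)
qed

text \<open>Elements of the old group are absorbed: into \<open>g\<close> after \<open>base\<close>
  or \<open>into\<close>, and without effect after \<open>out\<close>, since they fix every point
  outside \<open>I\<close>.\<close>

lemma reduced_gen:
  assumes "reduced w" "k \<in> gen S"
  shows "reduced (k \<circ> w)"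
  using assms(1)
proof cases
  case (base g)
  then show ?thesis by (intro reduced.base[OF gen_comp[OF assms(2) base(1)]]) simp
next
  case (out f)
  then have "(k \<circ> w) x = w x" if "x \<in> D" for x
    using gen_outside[OF assms(2)] h_in_I_iff that by simp
  then show ?thesis by (rule reduced_cong[OF assms(1)])
next
  case (into f g)
  then show ?thesis by (intro reduced.into[OF into(1) gen_comp[OF assms(2) into(2)]]) simp
qed

text \<open>After \<open>base\<close> and \<open>out\<close> the image of \<open>D\<close> misses
  \<open>V\<close>, so \<open>h\<close> can be appended. After \<open>into\<close> it lies in the
  translate of \<open>V\<close> by \<open>g\<close>: either \<open>g\<close> is trivial on
  \<open>V\<close> and \<open>h\<close> cancels the preceding inverse, or the translate misses
  \<open>V\<close> and \<open>h\<close> can again be appended.\<close>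

lemma reduced_h:
  assumes "reduced w"
  shows "reduced (h \<circ> w)"
  using assms
proof cases
  case (base g)
  have "w x \<notin> V" if "x \<in> D" for x
    using D_not_V[OF gen_D[OF base(1) that]] base(2)[OF that] by simp
  then show ?thesis by (intro reduced.out[OF assms]) simp
next
  case (out f)
  then have "w x \<notin> V" if "x \<in> D" for x using that h_in_I_iff V_I by auto
  then show ?thesis by (intro reduced.out[OF assms]) simp
next
  case (into f g)
  consider "\<forall>x\<in>V. g x = x" | "g ` V \<inter> V = {}" using wandering[OF into(2)] by blast
  then show ?thesis
  proof cases
    case 1
    have "(h \<circ> w) x = f x" if "x \<in> D" for x
      using into(3)[OF that] 1 inv_h_in_V_iff bij_h by (simp add: bij_is_surj surj_f_inv_f)
    then show ?thesis by (rule reduced_cong[OF into(1)])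
  next
    case 2
    have "w x \<notin> V" if "x \<in> D" for x
      using into(3)[OF that] 2 inv_h_in_V_iff by fastforce
    then show ?thesis by (intro reduced.out[OF assms]) simp
  qed
qed

text \<open>After \<open>out\<close> the inverse cancels \<open>h\<close>; otherwise the image of
  \<open>D\<close> lies in \<open>I\<close> and the inverse is appended with trivial
  \<open>g\<close>.\<close>

lemma reduced_inv_h:
  assumes "reduced w"
  shows "reduced (inv_fun h \<circ> w)"
  using assms
proof cases
  case (base g)
  then have "w x \<in> I" if "x \<in> D" for x
    using gen_D[OF base(1) that] base(2)[OF that] D_subset_I by auto
  then show ?thesis by (intro reduced.into[OF assms gen_id]) simp
next
  case (out f)
  then have "(inv_fun h \<circ> w) x = f x" if "x \<in> D" for x
    using that bij_h by (simp add: bij_is_inj)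
  then show ?thesis by (rule reduced_cong[OF out(1)])
next
  case (into f g)
  then have "w x \<in> I" if "x \<in> D" for x
    using that gen_inside[OF into(2)] inv_h_in_V_iff V_I by auto
  then show ?thesis by (intro reduced.into[OF assms gen_id]) simp
qed

lemma gen_insert_reduced: "w \<in> gen (insert h S) \<Longrightarrow> reduced w"
proof (induction rule: gen.induct)
  case gen_id
  then show ?case by (rule reduced.base[OF gen.gen_id]) simp
next
  case (gen_fun s f)
  then show ?case using reduced_h reduced_gen[OF _ gen_incl] by blast
next
  case (gen_inv s f)
  then show ?case using reduced_inv_h reduced_gen[OF _ gen_incl_inv] by blast
qed

text \<open>The last rule must be \<open>base\<close>: \<open>out\<close> sends \<open>D\<close>
  outside \<open>I\<close>, which contains \<open>D\<close>, and \<open>into\<close> sends it into a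
  translate of \<open>V\<close>, all of which are removed from \<open>D\<close>.\<close>

lemma dichotomy:
  assumes "w \<in> gen (insert h S)" "x \<in> D" "w x \<in> D"
  obtains g where "g \<in> gen S" "\<And>y. y \<in> D \<Longrightarrow> w y = g y"
  using gen_insert_reduced[OF assms(1)]
proof cases
  case (base g)
  then show ?thesis using that by blast
next
  case (out f)
  then have False using assms(2,3) h_in_I_iff D_subset_I by auto
  then show ?thesis ..
next
  case (into f g)
  then have "w x \<in> g ` V" using assms(2) inv_h_in_V_iff by blast
  then have False using assms(3) into(2) unfolding D_def by blast
  then show ?thesis ..
qed

end

section \<open>The tower of groups\<close>

lemma ex_one_point_map:
  fixes a b p q :: rat
  assumes "a < p" "p < b" "a < q" "q < b"
  shows "\<exists>f. strict_mono f \<and> bij f \<and> f p = q \<and> (\<forall>x. x \<le> a \<or> b \<le> x \<longrightarrow> f x = x)"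
proof -
  \<comment> \<open>Linear interpolation on either side of the break point \<open>p\<close>. With
    \<open>p\<close> and \<open>q\<close> as parameters, the inverse is
    \<open>F q p\<close>.\<close>
  define F where "F p q x = (if x \<le> a \<or> b \<le> x then x
      else if x \<le> p then a + (x - a) * ((q - a) / (p - a)) else b - (b - x) * ((b - q) / (b - p)))"
    for p q x :: rat
  have low: "a < F p q x \<and> F p q x \<le> q \<and> F p q x = a + (x - a) * ((q - a) / (p - a))"
    if "a < p" "p < b" "a < q" "q < b" "a < x" "x \<le> p" for p q x
  proof -
    have "(x - a) * ((q - a) / (p - a)) \<le> (p - a) * ((q - a) / (p - a))"
      using that by (intro mult_right_mono) auto
    moreover have "0 < (x - a) * ((q - a) / (p - a))" using that by auto
    ultimately show ?thesis using that by (auto simp: F_def)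
  qed
  have high: "q < F p q x \<and> F p q x < b \<and> F p q x = b - (b - x) * ((b - q) / (b - p))"
    if "a < p" "p < b" "a < q" "q < b" "p < x" "x < b" for p q x
  proof -
    have "(b - x) * ((b - q) / (b - p)) < (b - p) * ((b - q) / (b - p))"
      using that by (intro mult_strict_right_mono) auto
    moreover have "0 < (b - x) * ((b - q) / (b - p))" using that by auto
    ultimately show ?thesis using that by (auto simp: F_def)
  qed
  have outer: "F p q x = x" if "x \<le> a \<or> b \<le> x" for p q x
    using that by (auto simp: F_def)
  have inverse: "F q p (F p q x) = x" if pq: "a < p" "p < b" "a < q" "q < b" for p q x
  proof -
    consider "x \<le> a \<or> b \<le> x" | "a < x" "x \<le> p" | "p < x" "x < b" by linarith
    then show ?thesis
    proof cases
      case 1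
      then show ?thesis by (simp add: outer)
    next
      case 2
      note 3 = low[OF pq 2]
      have "F q p (F p q x) = a + (F p q x - a) * ((p - a) / (q - a))"
        using low[of q p "F p q x"] 3 pq by blast
      also have "\<dots> = a + (x - a) * ((q - a) / (p - a) * ((p - a) / (q - a)))" using 3 by simp
      also have "(q - a) / (p - a) * ((p - a) / (q - a)) = 1" using pq by simp
      finally show ?thesis by simp
    next
      case 3
      note 4 = high[OF pq 3]
      have "F q p (F p q x) = b - (b - F p q x) * ((b - p) / (b - q))"
        using high[of q p "F p q x"] 4 pq by blast
      also have "\<dots> = b - (b - x) * ((b - q) / (b - p) * ((b - p) / (b - q)))" using 4 by simp
      also have "(b - q) / (b - p) * ((b - p) / (b - q)) = 1" using pq by simp
      finally show ?thesis by simp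
    qed
  qed
  have "strict_mono (F p q)"
  proof (rule strict_monoI)
    fix x y :: rat assume xy: "x < y"
    have L: "(x - a) * ((q - a) / (p - a)) < (y - a) * ((q - a) / (p - a))"
      using assms xy by (intro mult_strict_right_mono) auto
    have H: "(b - y) * ((b - q) / (b - p)) < (b - x) * ((b - q) / (b - p))"
      using assms xy by (intro mult_strict_right_mono) auto
    note x_low = low[OF assms, of x] and x_high = high[OF assms, of x]
      and y_low = low[OF assms, of y] and y_high = high[OF assms, of y]
    consider "x \<le> a" | "a < x" "x \<le> p" | "p < x" "x < b" | "b \<le> x" by linarith
    then show "F p q x < F p q y"
    proof cases
      case 1
      then show ?thesis using xy y_low y_high outer[of x] outer[of y] assms by fastforce
    next
      case 2
      consider "y \<le> p" | "p < y" "y < b" | "b \<le> y" by linarith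
      then show ?thesis
        by cases (use 2 xy L x_low y_low y_high outer[of y] assms in fastforce)+
    next
      case 3
      consider "y < b" | "b \<le> y" by linarith
      then show ?thesis
        by cases (use 3 xy H x_high y_high outer[of y] assms in fastforce)+
    next
      case 4
      then show ?thesis using xy outer[of x] outer[of y] by simp
    qed
  qed
  moreover have "bij (F p q)"
    using inverse[OF assms] inverse[OF assms(3,4,1,2)]
    by (intro bij_betw_byWitness[where f' = "F q p"]) auto
  moreover have "F p q p = q" using assms by (simp add: F_def)
  ultimately show ?thesis using outer by blast
qed

text \<open>First \<open>p\<close> is moved to \<open>p'\<close>; then the image of \<open>q\<close>
  is corrected by a map supported above \<open>p'\<close>, which leaves \<open>p'\<close> in
  place.\<close>

lemma ex_two_point_map:
  fixes a b :: rat
  assumes "a < p" "p < q" "q < b" "a < p'" "p' < q'" "q' < b"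
  shows "\<exists>f. strict_mono f \<and> bij f \<and> f p = p' \<and> f q = q' \<and> (\<forall>x. x \<le> a \<or> b \<le> x \<longrightarrow> f x = x)"
proof -
  obtain f where f: "strict_mono f" "bij f" "f p = p'" "\<And>x. x \<le> a \<or> b \<le> x \<Longrightarrow> f x = x"
    using ex_one_point_map[of a p b p'] assms by auto
  have "p' < f q" using f(1,3) assms(2) by (metis strict_mono_less)
  moreover have "f q < b" using f(1) f(4)[of b] assms(3) by (metis order_refl strict_mono_less)
  ultimately obtain g where g: "strict_mono g" "bij g" "g (f q) = q'"
    "\<And>x. x \<le> p' \<or> b \<le> x \<Longrightarrow> g x = x"
    using ex_one_point_map[of p' "f q" b q'] assms by auto
  have "strict_mono (g \<circ> f)" "bij (g \<circ> f)"
    using f g by (auto simp: strict_mono_def intro: bij_comp)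
  moreover have "(g \<circ> f) p = p'" "(g \<circ> f) q = q'" "\<And>x. x \<le> a \<or> b \<le> x \<Longrightarrow> (g \<circ> f) x = x"
    using f g assms by auto
  ultimately show ?thesis by blast
qed

text \<open>The ratio 3 leaves room in the right half of \<open>U n\<close> for three pieces of
  equal length: the right half of \<open>U (Suc n)\<close>, then \<open>V n\<close>, then a gap
  before the end of \<open>U n\<close>.\<close>

definition radius :: "nat \<Rightarrow> rat" where
  "radius n = (1 / 3) ^ n"

lemma radius_Suc: "radius n = 3 * radius (Suc n)"
  by (simp add: radius_def)

lemma radius_pos: "0 < radius n"
  by (simp add: radius_def)

lemma radius_le_one: "radius n \<le> 1"
  by (simp add: radius_def power_le_one)

section \<open>Wandering intervals and inequivalent pairs\<close>

locale tower =
  fixes h :: "nat \<Rightarrow> rat \<Rightarrow> rat"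
  assumes mono_h: "strict_mono (h n)" and bij_h: "bij (h n)"
    and h_lower: "h n (radius (Suc n)) = - of_nat (Suc n)"
    and h_upper: "h n (2 * radius (Suc n)) = of_nat (Suc n)"
    and h_outside: "x \<le> - of_nat (Suc (Suc n)) \<or> of_nat (Suc (Suc n)) \<le> x \<Longrightarrow> h n x = x"
begin

definition I :: "nat \<Rightarrow> rat set" where "I n = {- of_nat (Suc n)<..<of_nat (Suc n)}"

definition U :: "nat \<Rightarrow> rat set" where "U n = {- radius n<..<radius n}"

definition V :: "nat \<Rightarrow> rat set" where "V n = {radius (Suc n)<..<2 * radius (Suc n)}"

abbreviation G :: "nat \<Rightarrow> (rat \<Rightarrow> rat) set" where "G n \<equiv> gen (h ` {..<n})"

abbreviation GG :: "(rat \<Rightarrow> rat) set" where "GG \<equiv> gen (range h)"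

abbreviation D :: "nat \<Rightarrow> rat set" where "D n \<equiv> ping_pong.D (h ` {..<n}) (I n) (V n)"

lemma V_subset_U: "V n \<subseteq> U n"
  using radius_Suc[of n] radius_pos[of "Suc n"] unfolding V_def U_def by auto

lemma U_subset_I: "U n \<subseteq> I n"
proof -
  have "radius n \<le> of_nat (Suc n)" using radius_le_one[of n] by (simp add: add_increasing2)
  then show ?thesis unfolding U_def I_def by auto
qed

lemma zero_in_U: "0 \<in> U n"
  using radius_pos unfolding U_def by simp

lemma h_V: "h n ` V n = I n"
proof
  show "h n ` V n \<subseteq> I n"
  proof (rule image_subsetI)
    fix x assume "x \<in> V n"
    then have "h n (radius (Suc n)) < h n x" "h n x < h n (2 * radius (Suc n))"
      unfolding V_def by (simp_all add: strict_mono_less[OF mono_h])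
    then show "h n x \<in> I n" by (simp only: h_lower h_upper I_def greaterThanLessThan_iff)
  qed
  show "I n \<subseteq> h n ` V n"
  proof
    fix y assume y: "y \<in> I n"
    obtain x where x: "y = h n x" using bij_h by (metis bij_pointE)
    then have "x \<in> V n"
      using y h_lower[of n] h_upper[of n] strict_mono_less[OF mono_h[of n]]
      unfolding V_def I_def by (metis greaterThanLessThan_iff)
    with x show "y \<in> h n ` V n" by blast
  qed
qed

text \<open>The point 0 lies to the left of \<open>V n\<close>, so it is pushed below all of
  \<open>I n\<close>.\<close>

lemma h_zero: "h n 0 < - of_nat (Suc n)"
  using strict_mono_less[OF mono_h] h_lower[of n] radius_pos[of "Suc n"] by metis

lemma bij_GG: "g \<in> GG \<Longrightarrow> bij g"
  by (erule gen_bij) (auto intro: bij_h)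

lemma inv_GG: "g \<in> GG \<Longrightarrow> inv_fun g \<in> GG"
  by (erule gen_inverse) (auto intro: bij_h)

lemma inv_G: "g \<in> G n \<Longrightarrow> inv_fun g \<in> G n"
  by (erule gen_inverse) (auto intro: bij_h)

lemma strict_mono_GG: "g \<in> GG \<Longrightarrow> strict_mono g"
  by (erule gen_strict_mono) (auto intro: bij_h mono_h)

lemma G_mono: "g \<in> G m \<Longrightarrow> m \<le> n \<Longrightarrow> g \<in> G n"
  by (erule gen_subset) auto

lemma h_in_G: "i < n \<Longrightarrow> h i \<in> G n"
  by (simp add: gen_incl)

lemma G_Suc: "G (Suc n) = gen (insert (h n) (h ` {..<n}))"
  by (simp add: lessThan_Suc)

lemma h_fixes_outside: "i < n \<Longrightarrow> x \<notin> I n \<Longrightarrow> h i x = x"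
proof (rule h_outside)
  assume "i < n" "x \<notin> I n"
  moreover from this have "(of_nat (Suc (Suc i)) :: rat) \<le> of_nat (Suc n)"
    by (simp only: of_nat_le_iff)
  ultimately show "x \<le> - of_nat (Suc (Suc i)) \<or> of_nat (Suc (Suc i)) \<le> x"
    unfolding I_def by (simp only: greaterThanLessThan_iff) linarith
qed

text \<open>The wandering property is a hypothesis for the single level \<open>n\<close>, so that
  ping-pong is available inside the induction that establishes it for all levels.\<close>

lemma ping_pongI:
  assumes "\<And>g. g \<in> G n \<Longrightarrow> (\<forall>x\<in>U n. g x = x) \<or> g ` U n \<inter> U n = {}"
  shows "ping_pong (h ` {..<n}) (I n) (V n) (h n)"
proof
  show "(\<forall>x\<in>V n. g x = x) \<or> g ` V n \<inter> V n = {}" if "g \<in> G n" for g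
    using assms[OF that] V_subset_U[of n] by blast
  show "V n \<subseteq> I n" by (rule order_trans[OF V_subset_U U_subset_I])
qed (auto simp: bij_h h_V h_fixes_outside)

text \<open>A translate of \<open>V n\<close> can meet \<open>U n\<close> only if the translating
  element fixes \<open>U n\<close> pointwise. The translate is then \<open>V n\<close> itself, which
  is disjoint from \<open>U (Suc n)\<close>.\<close>

lemma U_Suc_subset_D:
  assumes U: "\<And>g. g \<in> G n \<Longrightarrow> (\<forall>x\<in>U n. g x = x) \<or> g ` U n \<inter> U n = {}"
  shows "U (Suc n) \<subseteq> D n"
proof
  fix x assume x: "x \<in> U (Suc n)"
  then have xU: "x \<in> U n" and xV: "x \<notin> V n"
    using radius_Suc[of n] radius_pos[of "Suc n"] unfolding U_def V_def by auto
  have "x \<notin> g ` V n" if "g \<in> G n" for g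
  proof
    assume "x \<in> g ` V n"
    then obtain v where v: "x = g v" "v \<in> V n" by (rule imageE)
    then have "v \<in> U n" using V_subset_U by blast
    then have "g v = v" using U[OF that] v(1) xU by auto
    then show False using v xV by simp
  qed
  then show "x \<in> D n"
    using ping_pong.D_def[OF ping_pongI[OF U]] xU U_subset_I by blast
qed

text \<open>Induction on the level, starting from the trivial group. An element returning a point of
  \<open>U (Suc n)\<close> to \<open>U (Suc n)\<close> agrees on \<open>D n\<close> with some
  \<open>k\<close> in \<open>G n\<close>; as \<open>k\<close> returns a point of \<open>U n\<close>
  to \<open>U n\<close>, it is trivial there by induction.\<close>

lemma wandering: "g \<in> G n \<Longrightarrow> (\<forall>x\<in>U n. g x = x) \<or> g ` U n \<inter> U n = {}"
proof (induction n arbitrary: g)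
  case 0
  then have "g = id" by simp (induction rule: gen.induct, auto)
  then show ?case by simp
next
  case (Suc n)
  interpret pp: ping_pong "h ` {..<n}" "I n" "V n" "h n"
    using ping_pongI Suc.IH .
  have UD: "U (Suc n) \<subseteq> D n" using U_Suc_subset_D Suc.IH .
  have UU: "U (Suc n) \<subseteq> U n"
    using radius_Suc[of n] radius_pos[of "Suc n"] unfolding U_def by auto
  show ?case
  proof (rule disjCI)
    assume "g ` U (Suc n) \<inter> U (Suc n) \<noteq> {}"
    then obtain x where x: "x \<in> U (Suc n)" "g x \<in> U (Suc n)" by blast
    obtain k where k: "k \<in> G n" "\<And>y. y \<in> D n \<Longrightarrow> g y = k y"
      using pp.dichotomy[of g x] Suc.prems UD x unfolding G_Suc by blast
    have "k x \<in> U n" "x \<in> U n" using k(2) UD UU x by force+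
    then have "\<forall>y\<in>U n. k y = y" using Suc.IH[OF k(1)] by blast
    then show "\<forall>y\<in>U (Suc n). g y = y" using k(2) UD UU by (metis subsetD)
  qed
qed

sublocale level: ping_pong "h ` {..<n}" "I n" "V n" "h n" for n
  by (rule ping_pongI[OF wandering])

lemma zero_in_D: "0 \<in> D n"
  using U_Suc_subset_D[OF wandering] zero_in_U by blast

lemma orbit_in_I: "g \<in> G n \<Longrightarrow> g 0 \<in> I n"
  using level.gen_inside zero_in_U U_subset_I by blast

text \<open>Since \<open>g\<close> moves 0, it moves \<open>U n\<close> off itself. Hence a positive
  \<open>g 0\<close> lies to the right of \<open>U n\<close>, thus beyond \<open>V n\<close>, and
  \<open>h n\<close> throws it above \<open>I n\<close>.\<close>

lemma orbit_beyond_V: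
  assumes "g \<in> G n" "0 < g 0"
  shows "of_nat (Suc n) < h n (g 0)"
proof -
  have "g 0 \<notin> U n" using wandering[OF assms(1)] zero_in_U[of n] assms(2) by force
  then have "2 * radius (Suc n) < g 0"
    using assms(2) radius_Suc[of n] radius_pos[of "Suc n"] unfolding U_def by auto
  then show ?thesis using strict_mono_less[OF mono_h] h_upper by metis
qed

text \<open>The lower bound \<open>m\<close> serves to bring several elements to a common
  level.\<close>

lemma GG_level:
  assumes "f \<in> GG"
  obtains n where "m \<le> n" "f \<in> G n"
  using gen_range[OF assms] G_mono by (metis max.cobounded1 max.cobounded2)

text \<open>At the bottom \<open>w\<close> commutes with \<open>h 0\<close>, so fixing 0 forces it
  to fix \<open>h 0 0\<close>, which \<open>h 0\<close> moves. Higher up, \<open>w\<close> returns 0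
  to \<open>D (Suc n)\<close>, so there it agrees with an element one level down; both 0 and
  \<open>h 0 0\<close> belong to this set.\<close>

lemma not_doubly_transitive_level:
  "w \<in> G (Suc n) \<Longrightarrow> w 0 = 0 \<Longrightarrow> w (h 0 0) \<noteq> h 0 (h 0 0)"
proof (induction n arbitrary: w)
  case 0
  have "h 0 0 \<noteq> 0" using h_zero[of 0] by simp
  then have "h 0 0 \<noteq> h 0 (h 0 0)" using bij_is_inj[OF bij_h] by (metis injD)
  moreover have "w (h 0 0) = h 0 (w 0)"
    using gen_singleton_commute[OF _ bij_h] "0.prems"(1) by (simp add: lessThan_Suc)
  ultimately show ?case using "0.prems"(2) by simp
next
  case (Suc n)
  obtain g where g: "g \<in> G (Suc n)" "\<And>y. y \<in> D (Suc n) \<Longrightarrow> w y = g y"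
    using level.dichotomy[of w "Suc n" 0] zero_in_D[of "Suc n"] Suc.prems unfolding G_Suc[of "Suc n"]
    by metis
  have "h 0 0 \<in> D (Suc n)" using level.gen_D[OF h_in_G zero_in_D] by simp
  then show ?case using Suc.IH[OF g(1)] g(2) zero_in_D[of "Suc n"] Suc.prems(2) by simp
qed

section \<open>The orbit of zero\<close>

definition X :: "rat set" where "X = (\<lambda>g. g 0) ` GG"

lemma orbit_in_X: "g \<in> GG \<Longrightarrow> g 0 \<in> X"
  unfolding X_def by (rule imageI)

lemma X_cases:
  assumes "x \<in> X"
  obtains g where "g \<in> GG" "x = g 0"
  using assms unfolding X_def by (elim imageE)

lemma GG_X:
  assumes "g \<in> GG" "x \<in> X"
  shows "g x \<in> X"
  using assms(2)
proof (cases rule: X_cases)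
  case (1 f)
  then show ?thesis using orbit_in_X[OF gen_comp[OF assms(1) 1(1)]] by simp
qed

lemma X_transitive:
  assumes "x \<in> X" "y \<in> X"
  shows "\<exists>g\<in>GG. g x = y"
proof -
  obtain f g where f: "f \<in> GG" "x = f 0" and g: "g \<in> GG" "y = g 0"
    using assms X_cases by metis
  have "(g \<circ> inv_fun f) x = y" using bij_GG[OF f(1)] f(2) g(2) by (simp add: bij_is_inj)
  then show ?thesis by (rule bexI[OF _ gen_comp[OF g(1) inv_GG[OF f(1)]]])
qed

text \<open>As every \<open>h n\<close> moves 0 to the left, the start is the positive point to
  which the inverse of \<open>h 0\<close> takes 0; a later map then throws it arbitrarily
  high.\<close>

lemma X_above: "\<exists>x\<in>X. of_nat n < x"
proof -
  have "0 < inv_fun (h 0) 0"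
  proof -
    have "h 0 (inv_fun (h 0) 0) = 0" using bij_h by (simp add: bij_is_surj surj_f_inv_f)
    then show ?thesis using h_zero[of 0] strict_mono_less[OF mono_h, of 0 0 "inv_fun (h 0) 0"] by simp
  qed
  moreover have "inv_fun (h 0) \<in> G (Suc n)" by (simp add: gen_incl_inv)
  ultimately have "of_nat (Suc (Suc n)) < h (Suc n) (inv_fun (h 0) 0)" by (rule orbit_beyond_V[rotated])
  moreover have "h (Suc n) (inv_fun (h 0) 0) \<in> X"
    by (rule GG_X[OF gen_incl[OF rangeI] orbit_in_X[OF gen_incl_inv[OF rangeI]]])
  ultimately show ?thesis by (intro bexI) auto
qed

lemma X_below: "\<exists>x\<in>X. x < - of_nat n"
proof -
  have "h n 0 \<in> X" by (rule orbit_in_X[OF gen_incl[OF rangeI]])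
  moreover have "h n 0 < - of_nat n" using h_zero[of n] by simp
  ultimately show ?thesis by blast
qed

lemma X_expand:
  assumes "a \<in> X" "b \<in> X" "a < b" "c \<in> X" "d \<in> X"
  shows "\<exists>w\<in>GG. w a < c \<and> d < w b"
proof -
  obtain f g k l where *: "f \<in> GG" "g \<in> GG" "k \<in> GG" "l \<in> GG"
    "a = f 0" "b = g 0" "c = k 0" "d = l 0"
    using assms(1,2,4,5) X_cases by metis
  \<comment> \<open>All four elements are brought to one level \<open>n\<close>, so that
    \<open>c\<close> and \<open>d\<close> lie in \<open>I n\<close>, beyond whose ends
    \<open>w\<close> is to carry \<open>a\<close> and \<open>b\<close>.\<close>
  obtain n1 where n1: "f \<in> G n1" using GG_level[OF *(1), of 0] .
  obtain n2 where n2: "n1 \<le> n2" "g \<in> G n2" using GG_level[OF *(2)] .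
  obtain n3 where n3: "n2 \<le> n3" "k \<in> G n3" using GG_level[OF *(3)] .
  obtain n where n4: "n3 \<le> n" "l \<in> G n" using GG_level[OF *(4)] .
  have n: "f \<in> G n" "g \<in> G n" "k \<in> G n" "l \<in> G n"
    using G_mono[OF n1] G_mono[OF n2(2)] G_mono[OF n3(2)] n2(1) n3(1) n4 by simp_all
  define w where "w = h n \<circ> inv_fun f"
  have w: "w \<in> GG" unfolding w_def by (rule gen.gen_fun[OF rangeI inv_GG[OF *(1)]])
  have inv_a: "inv_fun f a = 0" using *(1,5) bij_GG by (simp add: bij_is_inj)
  then have "w a < c" using h_zero[of n] orbit_in_I[OF n(3)] *(7) unfolding w_def I_def by simp
  moreover have "d < w b"
  proof -
    have "0 < inv_fun f b"
      using inv_a strict_mono_GG[OF inv_GG[OF *(1)]] assms(3) by (metis strict_mono_less)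
    then have "of_nat (Suc n) < h n ((inv_fun f \<circ> g) 0)"
      using orbit_beyond_V[OF gen_comp[OF inv_G[OF n(1)] n(2)]] *(6) by simp
    then show ?thesis using orbit_in_I[OF n(4)] *(6,8) unfolding w_def I_def by simp
  qed
  ultimately show ?thesis using w by blast
qed

lemma dense_unbounded_X: "dense_unbounded X"
  unfolding dense_unbounded_def
proof (intro conjI ballI impI)
  show "X \<noteq> {}" using X_above by blast
  fix x assume x: "x \<in> X"
  then obtain g where g: "g \<in> GG" "x = g 0" by (rule X_cases)
  obtain n where "g \<in> G n" using GG_level[OF g(1), of 0] .
  then have xI: "- of_nat (Suc n) < x" "x < of_nat (Suc n)" using orbit_in_I g(2) unfolding I_def by auto
  show "\<exists>y\<in>X. y < x" using xI X_below[of "Suc n"] less_trans by blast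
  show "\<exists>y\<in>X. x < y" using xI X_above[of "Suc n"] less_trans by blast
  fix y assume y: "y \<in> X" "x < y"
  \<comment> \<open>Stretching \<open>(x, y)\<close> over \<open>x\<close> itself gives density: the
    preimage of \<open>x\<close> under \<open>w\<close> lies strictly between \<open>x\<close> and
    \<open>y\<close>.\<close>
  obtain w where w: "w \<in> GG" "w x < x" "x < w y" using X_expand[OF x y x x] by blast
  have "w (inv_fun w x) = x" using bij_GG[OF w(1)] by (simp add: bij_is_surj surj_f_inv_f)
  then have "x < inv_fun w x" "inv_fun w x < y"
    using w strict_mono_less[OF strict_mono_GG[OF w(1)]] by metis+
  then show "\<exists>z\<in>X. x < z \<and> z < y" using GG_X[OF inv_GG[OF w(1)] x] by blast
qed

end

lemma ex_tower: "\<exists>h. tower h"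
proof -
  have "\<exists>f. strict_mono f \<and> bij f \<and> f (radius (Suc n)) = - of_nat (Suc n)
      \<and> f (2 * radius (Suc n)) = of_nat (Suc n)
      \<and> (\<forall>x. x \<le> - of_nat (Suc (Suc n)) \<or> of_nat (Suc (Suc n)) \<le> x \<longrightarrow> f x = x)" for n
  proof -
    \<comment> \<open>These bounds put the end points of the stretched interval and their targets
      strictly inside the prescribed support.\<close>
    have "0 < radius (Suc n)" "3 * radius (Suc n) \<le> 1" "(0 :: rat) \<le> of_nat n"
      using radius_pos[of "Suc n"] radius_le_one[of n] radius_Suc[of n] by simp_all
    then show ?thesis unfolding of_nat_Suc by (intro ex_two_point_map; linarith)
  qed
  then show ?thesis unfolding tower_def by metis
qed

section \<open>Transport to the rationals\<close>

lemma carrier_BQ_iff: "f \<in> carrier BQ \<longleftrightarrow> bij f \<and> mono f \<and> boundedly_supported f"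
  by (simp add: BQ_def Bij_def)

lemma subgroup_BQ_I:
  assumes H: "H \<subseteq> carrier BQ" and id: "id \<in> H"
    and comp: "\<And>f g. f \<in> H \<Longrightarrow> g \<in> H \<Longrightarrow> f \<circ> g \<in> H"
    and inverse: "\<And>f. f \<in> H \<Longrightarrow> inv_fun f \<in> H"
  shows "subgroup H BQ"
proof (rule group.subgroupI[OF group_BQ H])
  show "H \<noteq> {}" using id by blast
  have mult: "f \<otimes>\<^bsub>BQ\<^esub> g = f \<circ> g" if "f \<in> H" "g \<in> H" for f g
  proof -
    have "f \<in> Bij UNIV" "g \<in> Bij UNIV" using H that by (auto simp: BQ_def)
    then show ?thesis by (simp add: BQ_def BijGroup_def compose_def fun_eq_iff)
  qed
  then show "f \<otimes>\<^bsub>BQ\<^esub> g \<in> H" if "f \<in> H" "g \<in> H" for f g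
    using comp[OF that] that by simp
  show "inv\<^bsub>BQ\<^esub> f \<in> H" if "f \<in> H" for f
  proof -
    have "bij f" using H that carrier_BQ_iff by auto
    then have "inv_fun f \<circ> f = id" by (simp add: bij_is_inj)
    moreover have "\<one>\<^bsub>BQ\<^esub> = id" by (simp add: BQ_def BijGroup_def fun_eq_iff)
    ultimately have "inv_fun f \<otimes>\<^bsub>BQ\<^esub> f = \<one>\<^bsub>BQ\<^esub>"
      using mult[OF inverse[OF that] that] by simp
    then have "inv\<^bsub>BQ\<^esub> f = inv_fun f"
      using that inverse[OF that] H by (intro group.inv_equality[OF group_BQ]) auto
    then show ?thesis using inverse[OF that] by simp
  qed
qed

section \<open>Conjugation by the order isomorphism onto the orbit\<close>

locale relabelled_tower = tower +
  fixes e :: "rat \<Rightarrow> rat"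
  assumes mono_e: "strict_mono e" and range_e: "range e = X"
begin

text \<open>Conjugation by \<open>e\<close>. Although \<open>e\<close> need not be onto the
  rationals, \<open>inv_fun e\<close> is a genuine inverse on \<open>X\<close>, and elements of
  \<open>GG\<close> preserve \<open>X\<close>.\<close>

definition relabel :: "(rat \<Rightarrow> rat) \<Rightarrow> rat \<Rightarrow> rat" where
  "relabel w = inv_fun e \<circ> w \<circ> e"

lemma inj_e: "inj e"
  by (rule strict_mono_imp_inj_on[OF mono_e])

lemma e_less_iff: "e x < e y \<longleftrightarrow> x < y"
  by (rule strict_mono_less[OF mono_e])

lemma e_in_X: "e x \<in> X"
  unfolding range_e[symmetric] by (rule rangeI)

lemma e_surj_X:
  assumes "y \<in> X"
  obtains x where "e x = y"
  using assms unfolding range_e[symmetric] by blast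

lemma e_relabel:
  assumes "w \<in> GG"
  shows "e (relabel w x) = w (e x)"
proof -
  have "w (e x) \<in> range e" unfolding range_e by (rule GG_X[OF assms e_in_X])
  then show ?thesis unfolding relabel_def by (simp add: f_inv_into_f)
qed

lemma relabel_eqI:
  assumes "w \<in> GG" "w (e x) = e y"
  shows "relabel w x = y"
  by (rule injD[OF inj_e]) (simp only: e_relabel[OF assms(1)] assms(2))

lemma relabel_inv:
  assumes "w \<in> GG"
  shows "relabel (inv_fun w) (relabel w x) = x" "relabel w (relabel (inv_fun w) x) = x"
  using bij_GG[OF assms]
  by (intro relabel_eqI inv_GG assms; simp add: e_relabel assms inv_GG bij_is_inj bij_is_surj surj_f_inv_f)+

lemma bij_relabel: "w \<in> GG \<Longrightarrow> bij (relabel w)"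
  by (rule bij_betw_byWitness[where f' = "relabel (inv_fun w)"]) (simp_all add: relabel_inv)

lemma strict_mono_relabel:
  assumes "w \<in> GG"
  shows "strict_mono (relabel w)"
proof (rule strict_monoI)
  fix x y :: rat assume "x < y"
  then have "e (relabel w x) < e (relabel w y)"
    by (simp add: e_relabel[OF assms] strict_mono_less[OF strict_mono_GG[OF assms]] e_less_iff)
  then show "relabel w x < relabel w y" by (simp only: e_less_iff)
qed

text \<open>The support of \<open>w\<close> lies in some \<open>I n\<close>, and \<open>X\<close>
  has points beyond both ends of \<open>I n\<close>; their labels bound the relabelled
  support.\<close>

lemma boundedly_supported_relabel:
  assumes "w \<in> GG"
  shows "boundedly_supported (relabel w)"
proof -
  obtain n where n: "w \<in> G n" using GG_level[OF assms, of 0] .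
  obtain p where "p \<in> X" "p < - of_nat (Suc n)" using X_below by blast
  then obtain a where a: "e a < - of_nat (Suc n)" using e_surj_X by metis
  obtain q where "q \<in> X" "of_nat (Suc n) < q" using X_above by blast
  then obtain b where b: "of_nat (Suc n) < e b" using e_surj_X by metis
  have "a < x \<and> x < b" if "relabel w x \<noteq> x" for x
  proof -
    have "w (e x) \<noteq> e x" using that relabel_eqI[OF assms] by blast
    then have "e x \<in> I n" using level.gen_outside[OF n] by blast
    then have "e a < e x" "e x < e b" using a b unfolding I_def by auto
    then show ?thesis by (simp only: e_less_iff simp_thms)
  qed
  then show ?thesis unfolding boundedly_supported_def by blast
qed

lemma subgroup_relabel: "subgroup (relabel ` GG) BQ"
proof (rule subgroup_BQ_I)
  show "relabel ` GG \<subseteq> carrier BQ"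
    using bij_relabel strict_mono_mono[OF strict_mono_relabel] boundedly_supported_relabel
    by (auto simp: carrier_BQ_iff)
  have "relabel id = id" by (rule ext) (simp add: relabel_eqI[OF gen_id])
  then show "id \<in> relabel ` GG" by (metis gen_id imageI)
  fix f assume "f \<in> relabel ` GG"
  then obtain v where v: "f = relabel v" "v \<in> GG" by (rule imageE)
  have "inv_fun f = relabel (inv_fun v)"
    unfolding v(1) using relabel_inv[OF v(2)] by (intro inv_equality)
  then show "inv_fun f \<in> relabel ` GG" using inv_GG[OF v(2)] by simp
  fix g assume "g \<in> relabel ` GG"
  then obtain w where w: "g = relabel w" "w \<in> GG" by (rule imageE)
  have "relabel (v \<circ> w) = f \<circ> g"
    unfolding v(1) w(1)
    by (rule ext, rule relabel_eqI[OF gen_comp[OF v(2) w(2)]]) (simp add: e_relabel v w)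
  then show "f \<circ> g \<in> relabel ` GG" using gen_comp[OF v(2) w(2)] by (metis imageI)
qed

lemma transitive_relabel: "\<exists>g\<in>relabel ` GG. g x = y"
proof -
  obtain w where "w \<in> GG" "w (e x) = e y" using X_transitive[OF e_in_X e_in_X] by blast
  then show ?thesis using relabel_eqI by blast
qed

lemma proximal_relabel: "proximal (relabel ` GG)"
  unfolding proximal_def
proof (intro allI impI)
  fix a b c d :: rat assume "a < b" "c < d"
  then have "e a < e b" by (simp only: e_less_iff)
  then obtain w where w: "w \<in> GG" "w (e a) < e c" "e d < w (e b)"
    using X_expand e_in_X by metis
  have "e (relabel w a) < e c" "e d < e (relabel w b)"
    using w(2,3) by (simp_all only: e_relabel[OF w(1)])
  then have ac: "relabel w a < c" and db: "d < relabel w b" by (simp_all only: e_less_iff)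
  have "{c<..<d} \<subseteq> relabel w ` {a<..<b}"
  proof
    fix y assume y: "y \<in> {c<..<d}"
    obtain x where x: "y = relabel w x" using bij_relabel[OF w(1)] by (metis bij_pointE)
    have "relabel w a < relabel w x" "relabel w x < relabel w b" using y ac db x by auto
    then have "x \<in> {a<..<b}" by (simp add: strict_mono_less[OF strict_mono_relabel[OF w(1)]])
    with x show "y \<in> relabel w ` {a<..<b}" by blast
  qed
  then show "\<exists>g\<in>relabel ` GG. {c<..<d} \<subseteq> g ` {a<..<b}" using w(1) by blast
qed

lemma not_doubly_transitive_relabel: "\<not> doubly_transitive (relabel ` GG)"
proof
  assume dt: "doubly_transitive (relabel ` GG)"
  have h: "h 0 \<in> GG" by (rule gen_incl[OF rangeI])
  have X0: "0 \<in> X" using orbit_in_X[OF gen_id] by simp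
  obtain z where z: "e z = 0" using X0 by (rule e_surj_X)
  obtain p where p: "e p = h 0 0" using GG_X[OF h X0] by (rule e_surj_X)
  obtain q where q: "e q = h 0 (h 0 0)" using GG_X[OF h GG_X[OF h X0]] by (rule e_surj_X)
  \<comment> \<open>Double transitivity speaks of increasing pairs only, so both
    \<open>h 0 0\<close> and \<open>h 0 (h 0 0)\<close> must lie below the common second point
    0.\<close>
  have "h 0 0 < 0" using h_zero[of 0] by simp
  then have "h 0 (h 0 0) < 0" using strict_mono_less[OF mono_h] by (meson less_trans)
  with \<open>h 0 0 < 0\<close> have "e p < e z" "e q < e z" by (simp_all only: z p q)
  then have "p < z" "q < z" by (simp_all only: e_less_iff)
  then obtain w where w: "w \<in> GG" "relabel w p = q" "relabel w z = z"
    using dt unfolding doubly_transitive_def by blast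
  have "w 0 = 0" "w (h 0 0) = h 0 (h 0 0)"
    using e_relabel[OF w(1), of z] e_relabel[OF w(1), of p] w(2,3) z p q by simp_all
  moreover obtain n where "1 \<le> n" "w \<in> G n" using GG_level[OF w(1)] .
  then have "w \<in> G (Suc n)" using G_mono by simp
  ultimately show False using not_doubly_transitive_level by blast
qed

end

theorem theorem4p2:
  shows "\<exists>\<Gamma>. subgroup \<Gamma> BQ \<and> transitive_action (BQ\<lparr>carrier := \<Gamma>\<rparr>) UNIV (\<lambda>g. g)
    \<and> proximal \<Gamma> \<and> \<not> doubly_transitive \<Gamma>"
proof -
  obtain h where "tower h" using ex_tower ..
  then interpret tower h .
  have "dense_unbounded (UNIV :: rat set)"
    unfolding dense_unbounded_def using lt_ex gt_ex dense by auto
  then obtain e where "bij_betw e (UNIV :: rat set) X" "strict_mono e"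
    using cantor_isomorphism[of "UNIV :: rat set" X] dense_unbounded_X by auto
  then interpret relabelled_tower h e
    by unfold_locales (simp_all add: bij_betw_def)
  show ?thesis
    using subgroup_relabel transitive_relabel proximal_relabel not_doubly_transitive_relabel
      transitive_action_subgroup_BQ_iff by blast
qed

end
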